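(* Let $m\ge 5$ and let $n\ge 5$ be odd. Then the radio number of the stacked-book graph $G_{m,n}=S_m\Box P_n$ satisfies $$rn(G_{m,n})\le \tfrac{1}{2}\left(mn^2+2n+m-2\right).$$
   Context: $S_m$ is the star on $m$ vertices (one center adjacent to $m-1$ leaves) and $P_n$ is the path on $n$ vertices. The stacked-book graph $G_{m,n}=S_m\Box P_n$ is their Cartesian product, with vertex set $V(S_m)\times V(P_n)$; two vertices $(a,i),(b,j)$ are adjacent iff either $a=b$ and $ij\in E(P_n)$, or $i=j$ and $ab\in E(S_m)$. For a connected graph $G$ with diameter $\mathrm{diam}(G)$ and distance $d$, a radio labeling is a function $f:V(G)\to\mathbb{Z}_{\ge 0}$ with $|f(u)-f(v)|\ge \mathrm{diam}(G)+1-d(u,v)$ for all distinct $u,v\in V(G)$; its span is $\max f-\min f$, and the radio number $rn(G)$ is the minimum span over all radio labelings of $G$. *)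

theory Defs
  imports "Graph_Theory.Graph_Theory"
begin

text \<open>Undirected simple graphs are the symmetric loop-free pair digraphs (\<open>pair_graph\<close>) of the
  AFP entry Graph Theory: every edge is represented by its two orientations.\<close>

definition star_graph :: "nat \<Rightarrow> nat pair_pre_digraph" where
  "star_graph m = \<lparr> pverts = {..<m},
     parcs = {(a, b). a < m \<and> b < m \<and> a \<noteq> b \<and> (a = 0 \<or> b = 0)} \<rparr>"

definition path_graph :: "nat \<Rightarrow> nat pair_pre_digraph" where
  "path_graph n = \<lparr> pverts = {..<n},
     parcs = {(i, j). i < n \<and> j < n \<and> (j = Suc i \<or> i = Suc j)} \<rparr>"

definition cartesian_product ::
    "'a pair_pre_digraph \<Rightarrow> 'b pair_pre_digraph \<Rightarrow> ('a \<times> 'b) pair_pre_digraph" where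
  "cartesian_product G H = \<lparr> pverts = pverts G \<times> pverts H,
     parcs = {((a, i), (b, j)). (a, i) \<in> pverts G \<times> pverts H \<and> (b, j) \<in> pverts G \<times> pverts H \<and>
       (a = b \<and> (i, j) \<in> parcs H \<or> i = j \<and> (a, b) \<in> parcs G)} \<rparr>"

definition stacked_book :: "nat \<Rightarrow> nat \<Rightarrow> (nat \<times> nat) pair_pre_digraph" where
  "stacked_book m n = cartesian_product (star_graph m) (path_graph n)"

text \<open>The library's distance \<open>\<mu>\<close> is weighted and extended-real valued; \<open>gdist\<close> is its
  natural-number version for unit weights (lemma \<open>gdist_eq_\<mu>\<close> below). It is unspecified between
  vertices of different components.\<close>

definition gdist :: "'a pair_pre_digraph \<Rightarrow> 'a \<Rightarrow> 'a \<Rightarrow> nat" where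
  "gdist G u v = (LEAST k. \<exists>p. pre_digraph.awalk (with_proj G) u p v \<and> length p = k)"

definition diam :: "'a pair_pre_digraph \<Rightarrow> nat" where
  "diam G = Max {gdist G u v | u v. u \<in> pverts G \<and> v \<in> pverts G}"

definition radio_labeling :: "'a pair_pre_digraph \<Rightarrow> ('a \<Rightarrow> nat) \<Rightarrow> bool" where
  "radio_labeling G f \<longleftrightarrow> (\<forall>u\<in>pverts G. \<forall>v\<in>pverts G. u \<noteq> v \<longrightarrow>
     \<bar>int (f u) - int (f v)\<bar> \<ge> int (diam G) + 1 - int (gdist G u v))"

definition label_span :: "'a pair_pre_digraph \<Rightarrow> ('a \<Rightarrow> nat) \<Rightarrow> nat" where
  "label_span G f = Max (f ` pverts G) - Min (f ` pverts G)"

definition radio_number :: "'a pair_pre_digraph \<Rightarrow> nat" where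
  "radio_number G = (LEAST s. \<exists>f. radio_labeling G f \<and> label_span G f = s)"

lemma (in pair_wf_digraph) gdist_eq_\<mu>:
  assumes "reachable (with_proj G) u v"
  shows "ereal (real (gdist G u v)) = \<mu> (\<lambda>_. 1) u v"
proof -
  have cost: "awalk_cost (\<lambda>_. 1) p = real (length p)" for p :: "('a \<times> 'a) list"
    by (induction p) (auto simp: awalk_cost_def)
  have ex: "\<exists>k p. awalk u p v \<and> length p = k"
    using assms by (auto simp: reachable_awalk)
  obtain p where p: "awalk u p v" "length p = gdist G u v"
    using LeastI_ex[OF ex] unfolding gdist_def by blast
  have le: "gdist G u v \<le> length q" if "awalk u q v" for q
    unfolding gdist_def using that by (auto intro: Least_le)
  show ?thesis
    unfolding \<mu>_def cost
    by (rule INF_eqI[symmetric]) (use p le in \<open>auto, metis\<close>)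
qed

lemma pair_graph_stacked_book: "pair_graph (stacked_book m n)"
proof
  show "finite (parcs (stacked_book m n))"
    by (rule finite_subset[of _ "({..<m} \<times> {..<n}) \<times> ({..<m} \<times> {..<n})"])
      (auto simp: stacked_book_def cartesian_product_def star_graph_def path_graph_def)
qed (auto simp: stacked_book_def cartesian_product_def star_graph_def path_graph_def
       symmetric_def arcs_ends_def arc_to_ends_def with_proj_def image_iff
       intro!: symI)

end

theory Submission
  imports Defs
begin

text \<open>Write \<open>n = 2k + 1\<close>. A vertex at height \<open>h\<close> has weight \<open>\<bar>h - k\<bar>\<close>, plus one on a leaf, and
  the distance of two vertices on opposite sides of the middle level, with different pages or both on
  the spine, is the sum of their weights. List the vertices so that all consecutive pairs are of this
  kind and give consecutive vertices labels differing by exactly \<open>n + 2 - d\<close>: then the span is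
  determined by the sum of the weights and by the two end vertices, the spine vertices at heights
  \<open>k\<close> and \<open>k + 1\<close>. What remains is to keep non-consecutive vertices apart. For this the list consists
  of blocks going from the lower to the upper half: first the leaf blocks with offsets \<open>(k, 0, k)\<close>
  from the middle level, then those with offsets \<open>(r, k - r)\<close> for \<open>r = 1, \<dots>, k - 1\<close>, finally the
  spine blocks with offsets \<open>(j, k + 1 - j)\<close>; in the leaf blocks the pages rotate. Then nearby labels
  occur only within a block or in adjacent blocks.\<close>

section \<open>Distances in the stacked-book graph\<close>

definition star_dist :: "nat \<Rightarrow> nat \<Rightarrow> nat" where
  "star_dist a b = (if a = b then 0 else if a = 0 \<or> b = 0 then 1 else 2)"

text \<open>Of the two truncated differences at most one is nonzero, so their sum is the absolute
  height difference.\<close>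

definition book_dist :: "nat \<times> nat \<Rightarrow> nat \<times> nat \<Rightarrow> nat" where
  "book_dist u v = star_dist (fst u) (fst v) + ((snd u - snd v) + (snd v - snd u))"

lemma book_dist_commute: "book_dist u v = book_dist v u"
  by (simp add: book_dist_def star_dist_def)

lemma book_dist_triangle: "book_dist u w \<le> book_dist u v + book_dist v w"
proof -
  have "star_dist (fst u) (fst w) \<le> star_dist (fst u) (fst v) + star_dist (fst v) (fst w)"
    by (simp add: star_dist_def)
  then show ?thesis unfolding book_dist_def by linarith
qed

lemma book_dist_eq_0_iff: "book_dist u v = 0 \<longleftrightarrow> u = v"
  by (auto simp: book_dist_def star_dist_def prod_eq_iff)

lemma pverts_stacked_book: "pverts (stacked_book m n) = {..<m} \<times> {..<n}"
  by (simp add: stacked_book_def cartesian_product_def star_graph_def path_graph_def)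

lemma arcs_stacked_book_iff:
  "(u, v) \<in> parcs (stacked_book m n) \<longleftrightarrow>
     u \<in> {..<m} \<times> {..<n} \<and> v \<in> {..<m} \<times> {..<n} \<and> book_dist u v = 1"
  by (cases u; cases v)
    (auto simp: stacked_book_def cartesian_product_def star_graph_def path_graph_def
      book_dist_def star_dist_def)

text \<open>First step of a geodesic: correct the height first, then change pages through the center
  \<open>0\<close>.\<close>

lemma book_dist_step:
  assumes "u \<in> {..<m} \<times> {..<n}" "v \<in> {..<m} \<times> {..<n}" "u \<noteq> v"
  obtains w where "w \<in> {..<m} \<times> {..<n}" "book_dist u w = 1"
    "book_dist u v = Suc (book_dist w v)"
proof -
  obtain a i b j where uv: "u = (a, i)" "v = (b, j)" by fastforce
  consider "i < j" | "j < i" | "i = j" "a = 0" | "i = j" "a \<noteq> 0" by linarith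
  then show ?thesis
  proof cases
    case 1
    then show ?thesis using assms uv
      by (intro that[of "(a, Suc i)"]) (auto simp: book_dist_def star_dist_def)
  next
    case 2
    then show ?thesis using assms uv
      by (intro that[of "(a, i - 1)"]) (auto simp: book_dist_def star_dist_def)
  next
    case 3
    then show ?thesis using assms uv
      by (intro that[of v]) (auto simp: book_dist_def star_dist_def)
  next
    case 4
    then show ?thesis using assms uv
      by (intro that[of "(0, i)"]) (auto simp: book_dist_def star_dist_def)
  qed
qed

lemma stacked_book_awalk_exists:
  assumes "u \<in> {..<m} \<times> {..<n}" "v \<in> {..<m} \<times> {..<n}"
  shows "\<exists>p. pre_digraph.awalk (with_proj (stacked_book m n)) u p v \<and> length p = book_dist u v"
  using assms
proof (induction "book_dist u v" arbitrary: u)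
  case 0
  interpret pair_graph "stacked_book m n" by (rule pair_graph_stacked_book)
  show ?case using 0
    by (intro exI[of _ "[]"]) (auto simp: awalk_Nil_iff book_dist_eq_0_iff pverts_stacked_book)
next
  case (Suc d)
  interpret pair_graph "stacked_book m n" by (rule pair_graph_stacked_book)
  from Suc.hyps(2) have "u \<noteq> v" using book_dist_eq_0_iff[of v v] by auto
  then obtain w where w: "w \<in> {..<m} \<times> {..<n}" "book_dist u w = 1"
    "book_dist u v = Suc (book_dist w v)"
    using book_dist_step Suc.prems by metis
  moreover have "d = book_dist w v" using Suc.hyps(2) w(3) by simp
  ultimately obtain p where p: "awalk w p v" "length p = d" using Suc.hyps(1) Suc.prems by metis
  have "awalk u ((u, w) # p) v"
    using p w Suc.prems by (auto simp: awalk_Cons_iff arcs_stacked_book_iff)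
  then show ?case using p Suc.hyps(2) by (intro exI[of _ "(u, w) # p"]) auto
qed

text \<open>Every arc has \<open>book_dist\<close> 1, so the triangle inequality adds up along the
  walk.\<close>

lemma book_dist_le_awalk_length:
  assumes "pre_digraph.awalk (with_proj (stacked_book m n)) u p v"
  shows "book_dist u v \<le> length p"
  using assms
proof (induction p arbitrary: u)
  case Nil
  interpret pair_graph "stacked_book m n" by (rule pair_graph_stacked_book)
  show ?case using Nil by (simp add: awalk_Nil_iff book_dist_eq_0_iff)
next
  case (Cons e p)
  interpret pair_graph "stacked_book m n" by (rule pair_graph_stacked_book)
  from Cons.prems have e: "fst e = u" "(u, snd e) \<in> parcs (stacked_book m n)" "awalk (snd e) p v"
    by (auto simp: awalk_Cons_iff)
  have "book_dist u v \<le> book_dist u (snd e) + book_dist (snd e) v" by (rule book_dist_triangle)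
  also have "\<dots> \<le> 1 + length p"
    using Cons.IH e by (simp add: arcs_stacked_book_iff)
  finally show ?case by simp
qed

lemma gdist_stacked_book:
  assumes "u \<in> {..<m} \<times> {..<n}" "v \<in> {..<m} \<times> {..<n}"
  shows "gdist (stacked_book m n) u v = book_dist u v"
  unfolding gdist_def
proof (rule Least_equality)
  show "\<exists>p. pre_digraph.awalk (with_proj (stacked_book m n)) u p v \<and> length p = book_dist u v"
    by (rule stacked_book_awalk_exists[OF assms])
qed (use book_dist_le_awalk_length in blast)

lemma diam_stacked_book_le:
  assumes "0 < m" "0 < n"
  shows "diam (stacked_book m n) \<le> n + 1"
proof -
  let ?V = "{..<m} \<times> {..<n}"
  have *: "{gdist (stacked_book m n) u v | u v. u \<in> ?V \<and> v \<in> ?V} =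
      (\<lambda>(u, v). book_dist u v) ` (?V \<times> ?V)"
    by (force simp: gdist_stacked_book)
  have "book_dist u v \<le> n + 1" if "u \<in> ?V" "v \<in> ?V" for u v
    using that by (auto simp: book_dist_def star_dist_def)
  then show ?thesis
    using assms unfolding diam_def pverts_stacked_book *
    by (subst Max_le_iff) auto
qed

lemma mod_add_neq:
  fixes x y M :: nat
  assumes "x < y" "y < x + M"
  shows "x mod M \<noteq> y mod M"
  using assms by (metis add.commute mod_eq_dvd_iff_nat less_imp_le_nat nat_dvd_not_less
      zero_less_diff less_diff_conv2)

section \<open>The block sequence and its labels\<close>

locale book_labeling =
  fixes k M :: nat
  assumes k_ge: "2 \<le> k" and M_ge: "4 \<le> M"
begin

text \<open>Three ranges of block indices: triples for \<open>t < M\<close>, leaf pairs of round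
  \<open>r = t div M\<close> for \<open>M \<le> t < k * M\<close>, and spine blocks
  \<open>t = k * M + j\<close>.\<close>

definition lower_offset :: "nat \<Rightarrow> nat" where
  "lower_offset t = (if t < M then k else if t < k * M then t div M else Suc (t - k * M))"

definition upper_offset :: "nat \<Rightarrow> nat" where
  "upper_offset t = (if t < M then k else if t < k * M then k - t div M else k - (t - k * M))"

text \<open>On leaf blocks the lower, upper and middle pages are \<open>t\<close>,
  \<open>t + 2\<close> and \<open>t - 1\<close> modulo \<open>M\<close>, shifted by one because page
  0 is the spine. The shifts keep the pages of close labels apart within a block and between
  adjacent blocks.\<close>

definition lower :: "nat \<Rightarrow> nat \<times> nat" where
  "lower t = (if t < k * M then Suc (t mod M) else 0, k - lower_offset t)"

definition upper :: "nat \<Rightarrow> nat \<times> nat" where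
  "upper t = (if t < k * M then Suc ((t + 2) mod M) else 0, k + upper_offset t)"

definition middle :: "nat \<Rightarrow> nat \<times> nat" where
  "middle t = (Suc ((t + M - 1) mod M), k)"

text \<open>Tight steps \<open>2 * k + 3 - d\<close>: a pair has \<open>d = k + 2\<close>, a spine
  block \<open>d = k + 1\<close>, and a triple makes two steps with
  \<open>d = k + 2\<close>.\<close>

definition width :: "nat \<Rightarrow> nat" where
  "width t = (if t < M then 2 * k + 2 else if t < k * M then k + 1 else k + 2)"

text \<open>The gap between block \<open>t - 1\<close> and block \<open>t\<close>.\<close>

definition gap :: "nat \<Rightarrow> nat" where
  "gap t = (if t < M then 1 else if t < k * M then (if M dvd t then k else k + 1)
     else if t = k * M then 2 * k else k + 1)"

text \<open>The value \<open>k + 2\<close> is the tight step from the origin \<open>(0, k)\<close>,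
  labelled 0, to \<open>lower 0\<close> at distance \<open>k + 1\<close>.\<close>

fun start :: "nat \<Rightarrow> nat" where
  "start 0 = k + 2"
| "start (Suc t) = start t + width t + gap (Suc t)"

text \<open>A relation rather than a function: once every vertex has a label and labelled vertices
  are separated, choice yields the labeling, with no need to invert the indexing explicitly.\<close>

inductive labelled :: "nat \<times> nat \<Rightarrow> nat \<Rightarrow> bool" where
  origin: "labelled (0, k) 0"
| lower: "t < k * M + k \<Longrightarrow> labelled (lower t) (start t)"
| upper: "t < k * M + k \<Longrightarrow> labelled (upper t) (start t + width t)"
| middle: "t < M \<Longrightarrow> labelled (middle t) (start t + k + 1)"

lemma M_lt_kM: "M < k * M"
  using k_ge M_ge by simp

lemma not_less_M [simp]: "\<not> k * M + j < M" "\<not> Suc (k * M + j) < M"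
  using M_lt_kM by linarith+

lemma less_kM [simp]: "t < M \<Longrightarrow> t < k * M"
  using M_lt_kM by linarith

lemma lower_spine: "lower (k * M + j) = (0, k - Suc j)"
  by (simp add: lower_def lower_offset_def)

lemma upper_spine: "upper (k * M + j) = (0, k + (k - j))"
  by (simp add: upper_def upper_offset_def)

section \<open>Closed forms for the block labels and the largest label\<close>

lemma start_triples: "t < M \<Longrightarrow> start t = k + 2 + (2 * k + 3) * t"
  by (induction t) (auto simp: width_def gap_def algebra_simps)

lemma block_index:
  assumes "r < k" "i < M"
  shows "r * M + i < k * M" "(r * M + i) div M = r" "r * M + i < M \<longleftrightarrow> r = 0"
proof -
  have "r * M + i < Suc r * M" using assms by simp
  also have "\<dots> \<le> k * M" using assms by (intro mult_le_mono1) simp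
  finally show "r * M + i < k * M" .
  show div: "(r * M + i) div M = r" using assms by simp
  show "r * M + i < M \<longleftrightarrow> r = 0"
    using assms div by (cases "r = 0") (auto simp del: div_mult_self3 dest: div_less)
qed

text \<open>This concerns round \<open>r + 1\<close>. Pair blocks advance by
  \<open>2 * k + 2\<close>, except that entering each of the rounds \<open>2, ..., r + 1\<close>
  costs one less; the summand \<open>r\<close> on the left records these losses without
  subtraction.\<close>

lemma start_pairs:
  assumes "Suc r < k" "i < M"
  shows "start (Suc r * M + i) + r = M * (2 * k + 3) + 2 * k + 1 + (2 * k + 2) * (r * M + i)"
  using assms
proof (induction "r * M + i" arbitrary: r i rule: less_induct)
  case less
  show ?case
  proof (cases i)
    case (Suc i')
    then have i': "i' < M" using less.prems by simp
    have "start (Suc r * M + i') + r =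
        M * (2 * k + 3) + 2 * k + 1 + (2 * k + 2) * (r * M + i')"
      using less Suc by simp
    moreover have "\<not> M dvd Suc r * M + i"
      using Suc less.prems(2) by (subst dvd_add_right_iff) (auto intro: nat_dvd_not_less)
    then have "gap (Suc r * M + i) = k + 1"
      using block_index[of "Suc r" i] less.prems by (simp add: gap_def)
    moreover have "width (Suc r * M + i') = k + 1"
      using block_index[of "Suc r" i'] less.prems i' by (simp add: width_def)
    ultimately show ?thesis using Suc by (simp add: algebra_simps)
  next
    case 0
    \<comment> \<open>The preceding block \<open>r * M + M'\<close> closes the previous round; for
      \<open>r = 0\<close> it is a triple.\<close>
    obtain M' where M': "M = Suc M'" using M_ge by (cases M) auto
    then have "M' < M" by simp
    have step: "Suc r * M = Suc (r * M + M')" by (simp add: M')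
    have "start (Suc r * M) = start (r * M + M') + width (r * M + M') + gap (Suc r * M)"
      unfolding step by simp
    moreover have "gap (Suc r * M) = k"
      using block_index[of "Suc r" 0] less.prems by (simp add: gap_def)
    moreover have "start (r * M + M') + width (r * M + M') =
        (k + 1 + M * (2 * k + 3) + (2 * k + 2) * (r * M)) - r"
    proof (cases r)
      case 0
      have "start M' = k + 2 + (2 * k + 3) * M'" "width M' = 2 * k + 2"
        using \<open>M' < M\<close> by (auto simp: start_triples width_def)
      then show ?thesis using 0 M' by (simp add: algebra_simps)
    next
      case r: (Suc r')
      have "start (Suc r' * M + M') + r' =
          M * (2 * k + 3) + 2 * k + 1 + (2 * k + 2) * (r' * M + M')"
        using less.prems r M' by (intro less.hyps) auto
      moreover have "width (r * M + M') = k + 1"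
        using block_index[of r M'] less.prems \<open>M' < M\<close> r by (simp add: width_def del: mult_Suc)
      ultimately show ?thesis using M' r by (simp add: algebra_simps)
    qed
    moreover have "r \<le> k" using less.prems by simp
    ultimately show ?thesis using 0 by simp
  qed
qed

lemma start_spine: "start (k * M + j) = M * (2 * k * k + 2 * k + 1) + 2 * k + 2 + (2 * k + 3) * j"
proof (induction j)
  case 0
  obtain M' where M': "M = Suc M'" using M_ge by (cases M) auto
  obtain k' where k': "k = Suc (Suc k')" using k_ge by (metis add_2_eq_Suc le_Suc_ex)
  \<comment> \<open>The last leaf block is the last one of round \<open>k - 1\<close>, hence
    \<open>r = k - 2\<close> in \<open>start_pairs\<close>.\<close>
  have "start (Suc k' * M + M') + k' =
      M * (2 * k + 3) + 2 * k + 1 + (2 * k + 2) * (k' * M + M')"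
    by (rule start_pairs) (auto simp: k' M')
  moreover have Suc: "Suc (Suc k' * M + M') = k * M" by (simp add: k' M')
  moreover have "start (k * M) = start (Suc k' * M + M') + width (Suc k' * M + M') + gap (k * M)"
    by (metis Suc start.simps(2))
  moreover have "width (Suc k' * M + M') = k + 1"
    using Suc by (auto simp: width_def)
  moreover have "gap (k * M) = 2 * k" using M_lt_kM by (simp add: gap_def)
  ultimately show ?case by (simp add: k' M' algebra_simps)
next
  case (Suc j)
  then show ?case by (simp add: width_def gap_def)
qed

lemma start_mono: "t \<le> t' \<Longrightarrow> start t \<le> start t'"
  by (rule lift_Suc_mono_le[of start]) auto

lemma width_ge: "k + 1 \<le> width t"
  by (simp add: width_def)

lemma gap_ge: "1 \<le> gap t" "M \<le> t \<Longrightarrow> k \<le> gap t"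
  using k_ge by (auto simp: gap_def)

text \<open>No block ends later than the last spine block \<open>k * M + (k - 1)\<close>, whose end
  \<open>start_spine\<close> evaluates.\<close>

lemma labelled_le:
  assumes "labelled u x"
  shows "x \<le> (M + 1) * (2 * k * k + 2 * k + 1) + 2 * k"
proof -
  obtain k' where k': "k = Suc k'" using k_ge by (cases k) auto
  have last: "start (k * M + k') + (k + 2) = (M + 1) * (2 * k * k + 2 * k + 1) + 2 * k"
    unfolding start_spine by (simp add: k' algebra_simps)
  have *: "start t + width t \<le> start (k * M + k') + (k + 2)" if "t < k * M + k" for t
  proof (cases "t = k * M + k'")
    case True
    then show ?thesis by (simp add: width_def)
  next
    case False
    then have "start (Suc t) \<le> start (k * M + k')"
      using that k' by (intro start_mono) simp
    then show ?thesis by simp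
  qed
  from assms show ?thesis
  proof cases
    case (lower t)
    then show ?thesis using *[of t] last by simp
  next
    case (upper t)
    then show ?thesis using *[of t] last by simp
  next
    case (middle t)
    then have "x \<le> start t + width t" using width_ge[of t] by linarith
    also have "\<dots> \<le> start (k * M + k') + (k + 2)"
      using middle M_lt_kM by (intro *) linarith
    finally show ?thesis using last by linarith
  qed simp
qed

section \<open>Every vertex occurs in the list\<close>

lemma labelled_exists:
  assumes "c \<le> M" "l < 2 * k + 1"
  shows "\<exists>x. labelled (c, l) x"
proof (cases "c = 0")
  case True
  consider "l = k" | "l < k" | "k < l" by linarith
  then show ?thesis
  proof cases
    case 1
    then show ?thesis using True origin by blast
  next
    case 2
    have "lower (k * M + (k - l - 1)) = (c, l)"
      using 2 True by (subst lower_spine) simp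
    then show ?thesis using labelled.lower[of "k * M + (k - l - 1)"] 2 by auto
  next
    case 3
    have "upper (k * M + (2 * k - l)) = (c, l)"
      using 3 True assms by (subst upper_spine) simp
    then show ?thesis using labelled.upper[of "k * M + (2 * k - l)"] 3 k_ge by fastforce
  qed
next
  case False
  consider "l = k" | "l < k" | "k < l" by linarith
  then show ?thesis
  proof cases
    case 1
    \<comment> \<open>The middle page of block \<open>t\<close> is \<open>t\<close> itself, except
      that block 0 has page \<open>M\<close>.\<close>
    have "middle (c mod M) = (c, l)"
    proof -
      have "(c mod M + M - 1) mod M = c - 1"
      proof (cases "c = M")
        case False
        with assms \<open>c \<noteq> 0\<close> have "c mod M + M - 1 = c - 1 + M" "c - 1 < M" by auto
        then show ?thesis by simp
      qed (use \<open>c \<noteq> 0\<close> in simp)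
      then show ?thesis using 1 False by (simp add: middle_def)
    qed
    then show ?thesis using labelled.middle[of "c mod M"] M_ge by auto
  next
    case 2
    define r where "r = (if l = 0 then 0 else k - l)"
    have r: "r < k" "c - 1 < M" using 2 assms False by (auto simp: r_def)
    have "lower (r * M + (c - 1)) = (c, l)"
    proof -
      have "(r * M + (c - 1)) mod M = c - 1" using r by (simp del: One_nat_def)
      then show ?thesis using block_index[OF r] False 2
        by (auto simp: lower_def lower_offset_def r_def simp del: One_nat_def)
    qed
    then show ?thesis using labelled.lower[of "r * M + (c - 1)"] block_index(1)[OF r]
      by (metis trans_less_add1)
  next
    case 3
    \<comment> \<open>Upper offsets are \<open>k - r\<close> in round 0 too, so no case split
      arises. The index \<open>i\<close> solves \<open>i + 2 = c - 1\<close> modulo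
      \<open>M\<close>.\<close>
    define r where "r = 2 * k - l"
    define i where "i = (c + M - 3) mod M"
    have r: "r < k" "i < M" using 3 M_ge k_ge by (auto simp: r_def i_def)
    have "(r * M + i + 2) mod M = c - 1"
    proof -
      have "(r * M + i + 2) mod M = (i + 2) mod M"
        using mod_mult_self3[of r M "i + 2"] by (simp only: add.assoc)
      also have "\<dots> = (c + M - 3 + 2) mod M" unfolding i_def by (rule mod_add_left_eq)
      also have "c + M - 3 + 2 = c - 1 + M" using M_ge False by simp
      finally have "(r * M + i + 2) mod M = (c - 1) mod M" by simp
      moreover have "c - 1 < M" using False assms by simp
      ultimately show ?thesis by simp
    qed
    moreover have "upper_offset (r * M + i) = k - r"
      using block_index[OF r] by (simp add: upper_offset_def)
    moreover have "k + (k - r) = l" using 3 assms by (simp add: r_def)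
    ultimately have "upper (r * M + i) = (c, l)"
      using block_index(1)[OF r] False by (simp only: upper_def if_True) simp
    then show ?thesis using labelled.upper[of "r * M + i"] block_index(1)[OF r]
      by (metis trans_less_add1)
  qed
qed

section \<open>Separation of labelled vertices\<close>

text \<open>The radio condition with \<open>y\<close> as the larger label; \<open>2 * k + 3\<close>
  is \<open>n + 2\<close>, one more than the diameter bound \<open>n + 1\<close>. The disjunct
  \<open>u = v\<close> absorbs repeated vertices.\<close>

definition separated :: "nat \<times> nat \<Rightarrow> nat \<Rightarrow> nat \<times> nat \<Rightarrow> nat \<Rightarrow> bool" where
  "separated u x v y \<longleftrightarrow> u = v \<or> x + (2 * k + 3) \<le> y + book_dist u v"

lemma separatedI_far: "x + (2 * k + 2) \<le> y \<Longrightarrow> separated u x v y"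
  using book_dist_eq_0_iff[of u v] by (auto simp: separated_def)

text \<open>This is \<open>labelled\<close> without the origin and with the block index exposed, for
  a case split on how far apart two blocks are.\<close>

inductive in_block :: "nat \<Rightarrow> nat \<times> nat \<Rightarrow> nat \<Rightarrow> bool" for t where
  lower: "t < k * M + k \<Longrightarrow> in_block t (lower t) (start t)"
| upper: "t < k * M + k \<Longrightarrow> in_block t (upper t) (start t + width t)"
| middle: "t < M \<Longrightarrow> in_block t (middle t) (start t + k + 1)"

lemma labelled_cases_block:
  assumes "labelled u x"
  shows "u = (0, k) \<and> x = 0 \<or> (\<exists>t. in_block t u x)"
  using assms by cases (blast intro: in_block.intros)+

lemma in_block_bounds:
  assumes "in_block t u x"
  shows "start t \<le> x" "x \<le> start t + width t" "t < k * M + k"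
proof -
  have width: "t < M \<Longrightarrow> k + 1 \<le> width t" by (rule width_ge)
  show "start t \<le> x" using assms by cases simp_all
  show "x \<le> start t + width t" using assms width by cases simp_all
  show "t < k * M + k"
    using assms by cases (use M_lt_kM in linarith)+
qed

text \<open>The residues \<open>t - 1\<close> and \<open>t + 2\<close> differ by 3, which is where
  \<open>M \<ge> 4\<close> enters.\<close>

lemma pages_distinct:
  "t mod M \<noteq> (t + 2) mod M" "t mod M \<noteq> (t + M - 1) mod M" "(t + 2) mod M \<noteq> (t + M - 1) mod M"
  using M_ge by (intro mod_add_neq; simp)+

lemma pages_distinct_next:
  "t mod M \<noteq> Suc t mod M" "(t + 2) mod M \<noteq> Suc t mod M" "(t + 2) mod M \<noteq> (Suc t + 2) mod M"
  "(t + 2) mod M \<noteq> t mod M" "(t + M - 1) mod M \<noteq> Suc t mod M"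
proof -
  show "t mod M \<noteq> Suc t mod M" "(t + 2) mod M \<noteq> (Suc t + 2) mod M"
    using M_ge by (intro mod_add_neq; simp)+
  show "(t + 2) mod M \<noteq> Suc t mod M"
    using mod_add_neq[of "Suc t" "t + 2" M] M_ge by simp
  show "(t + 2) mod M \<noteq> t mod M"
    using pages_distinct(1)[of t] by simp
  have "Suc t mod M \<noteq> (t + M - 1) mod M"
    using M_ge by (intro mod_add_neq) auto
  then show "(t + M - 1) mod M \<noteq> Suc t mod M" by metis
qed

lemma separated_same_block:
  assumes "in_block t u x" "in_block t v y"
  shows "separated u x v y \<or> separated v y u x"
proof -
  \<comment> \<open>\<open>A\<close>, \<open>O\<close>, \<open>Z\<close> stand for the lower, middle
    and upper vertex. Only in a triple are \<open>A\<close> and \<open>Z\<close> far apart in label;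
    pairs and spine blocks meet the condition with equality.\<close>
  have AZ: "separated (lower t) (start t) (upper t) (start t + width t)" if "t < k * M + k"
  proof -
    consider "t < M" | "M \<le> t" "t < k * M" | "k * M \<le> t" by linarith
    then show ?thesis
    proof cases
      case 1
      then show ?thesis by (intro separatedI_far) (simp add: width_def)
    next
      case 2
      then have "t div M < k" by (intro less_mult_imp_div_less)
      then show ?thesis using 2 pages_distinct[of t]
        by (simp add: separated_def lower_def upper_def lower_offset_def upper_offset_def
            width_def book_dist_def star_dist_def)
    next
      case 3
      then obtain j where j: "t = k * M + j" by (auto simp: le_iff_add)
      with that show ?thesis
        by (simp add: separated_def lower_spine upper_spine width_def book_dist_def)
    qed
  qed
  have AO: "separated (lower t) (start t) (middle t) (start t + k + 1)" if "t < M"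
    using that pages_distinct[of t] M_lt_kM
    by (simp add: separated_def lower_def middle_def lower_offset_def book_dist_def star_dist_def)
  have OZ: "separated (middle t) (start t + k + 1) (upper t) (start t + width t)" if "t < M"
    using that pages_distinct[of t] M_lt_kM
    by (simp add: separated_def upper_def middle_def upper_offset_def width_def
        book_dist_def star_dist_def)
  have refl: "separated w x w y" for w x y by (simp add: separated_def)
  from assms AZ AO OZ refl show ?thesis
    by (elim in_block.cases) auto
qed

lemma separated_next_block:
  assumes "in_block t u x" "in_block (Suc t) v y"
  shows "separated u x v y"
proof -
  \<comment> \<open>\<open>C\<close>: both blocks are pairs and the second opens a new round. Then
    width plus gap is only \<open>2 * k + 1\<close>, one short of \<open>separatedI_far\<close>, and
    distinct pages must supply the missing distance.\<close>
  define C where "C \<longleftrightarrow> M \<le> t \<and> Suc t < k * M \<and> M dvd Suc t"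
  have t: "Suc t < k * M + k" using in_block_bounds[OF assms(2)] by simp
  have next_round: "Suc t div M = Suc (t div M)" "Suc t div M < k" if C
  proof -
    show "Suc t div M = Suc (t div M)"
      using that by (simp add: C_def div_Suc dvd_eq_mod_eq_0)
    show "Suc t div M < k" using that by (simp add: C_def less_mult_imp_div_less)
  qed
  have AA: "separated (lower t) (start t) (lower (Suc t)) (start (Suc t))"
  proof (cases C)
    case True
    then show ?thesis using next_round pages_distinct_next[of t]
      by (simp add: C_def separated_def lower_def lower_offset_def width_def gap_def
          book_dist_def star_dist_def)
  next
    case False
    then show ?thesis using k_ge
      by (intro separatedI_far) (auto simp: C_def width_def gap_def)
  qed
  \<comment> \<open>Consecutive vertices of the list: \<open>gap\<close> makes the condition an
    equality in every case.\<close>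
  have ZA: "separated (upper t) (start t + width t) (lower (Suc t)) (start (Suc t))"
  proof -
    consider "Suc t < M" | "Suc t = M" | "M \<le> t" "Suc t < k * M" | "Suc t = k * M"
      | "k * M \<le> t" by linarith
    then show ?thesis
    proof cases
      case 1
      then show ?thesis using pages_distinct_next[of t] M_lt_kM
        by (simp add: separated_def lower_def upper_def lower_offset_def upper_offset_def
            gap_def book_dist_def star_dist_def)
    next
      case 2
      then have "t < M" "\<not> Suc t < M" "Suc t < k * M" "Suc t div M = 1" "M dvd Suc t"
        using M_lt_kM M_ge by auto
      then show ?thesis using pages_distinct_next[of t] k_ge
        by (simp add: separated_def lower_def upper_def lower_offset_def upper_offset_def
            gap_def book_dist_def star_dist_def)
    next
      case 3
      then have "t div M < k" "Suc t div M < k" by (auto intro!: less_mult_imp_div_less)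
      moreover have "Suc t div M = (if M dvd Suc t then Suc (t div M) else t div M)"
        by (simp add: div_Suc dvd_eq_mod_eq_0)
      ultimately show ?thesis using 3 pages_distinct_next[of t]
        by (simp add: separated_def lower_def upper_def lower_offset_def upper_offset_def
            gap_def book_dist_def star_dist_def)
    next
      case 4
      have "t div M = k - 1"
        using 4 M_ge k_ge by (intro div_nat_eqI) (auto simp: algebra_simps diff_mult_distrib2)
      moreover have "M \<le> t" "t < k * M" using 4 M_lt_kM by linarith+
      ultimately have "snd (upper t) = Suc k" "0 < fst (upper t)"
        using k_ge by (auto simp: upper_def upper_offset_def)
      moreover have "lower (Suc t) = (0, k - 1)" "gap (Suc t) = 2 * k"
        using 4 lower_spine[of 0] not_less_M(1)[of 0] by (simp_all add: gap_def)
      ultimately show ?thesis using k_ge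
        by (simp add: separated_def book_dist_def star_dist_def)
    next
      case 5
      then obtain j where j: "t = k * M + j" by (auto simp: le_iff_add)
      with t show ?thesis
        using lower_spine[of "Suc j"]
        by (simp add: separated_def upper_spine gap_def book_dist_def)
    qed
  qed
  \<comment> \<open>Here the second block's width counts, so the passage from triples to pairs at
    \<open>Suc t = M\<close> is short as well.\<close>
  have ZZ: "separated (upper t) (start t + width t) (upper (Suc t)) (start (Suc t) + width (Suc t))"
  proof -
    consider "Suc t = M" | C | "Suc t \<noteq> M" "\<not> C" by blast
    then show ?thesis
    proof cases
      case 1
      then have "t < M" "\<not> Suc t < M" "Suc t < k * M" "Suc t div M = 1" "M dvd Suc t"
        using M_lt_kM M_ge by auto
      then show ?thesis using pages_distinct_next[of t] k_ge
        by (simp add: separated_def upper_def upper_offset_def width_def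
            gap_def book_dist_def star_dist_def)
    next
      case 2
      then show ?thesis using next_round pages_distinct_next[of t]
        by (simp add: C_def separated_def upper_def upper_offset_def width_def gap_def
            book_dist_def star_dist_def)
    next
      case 3
      then show ?thesis using k_ge
        by (intro separatedI_far) (auto simp: C_def width_def gap_def)
    qed
  qed
  \<comment> \<open>The labels differ by \<open>k + 2\<close> and the heights by \<open>k\<close>,
    so different pages are essential.\<close>
  have ZO: "separated (upper t) (start t + width t) (middle (Suc t)) (start (Suc t) + k + 1)"
    if "Suc t < M"
    using that pages_distinct_next[of t] M_lt_kM
    by (simp add: separated_def upper_def middle_def upper_offset_def gap_def
        book_dist_def star_dist_def)
  have OA: "separated (middle t) (start t + k + 1) (lower (Suc t)) (start (Suc t))" if "t < M"
  proof (cases "Suc t < M")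
    case True
    then show ?thesis using pages_distinct_next[of t] M_lt_kM
      by (simp add: separated_def lower_def middle_def lower_offset_def width_def gap_def
          book_dist_def star_dist_def)
  next
    case False
    then have t': "Suc t = M" using that by simp
    \<comment> \<open>At the passage to the pairs the labels differ by \<open>2 * k + 1\<close>, so
      the distance 2 between distinct leaf pages is already enough.\<close>
    have "gap (Suc t) = k"
      unfolding t' using M_lt_kM by (simp add: gap_def del: n_less_m_mult_n)
    then have "start (Suc t) = start t + (2 * k + 2) + k"
      using that by (simp add: width_def)
    moreover have "2 \<le> book_dist (middle t) (lower (Suc t))"
      using t' M_lt_kM pages_distinct_next[of t]
      by (simp add: lower_def middle_def book_dist_def star_dist_def)
    ultimately show ?thesis by (simp add: separated_def del: start.simps)
  qed
  \<comment> \<open>The remaining combinations are far: each bridges at least two steps of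
    \<open>k + 1\<close> and a gap, or a whole triple and a gap.\<close>
  have AZ: "separated (lower t) (start t) (upper (Suc t)) (start (Suc t) + width (Suc t))"
    using width_ge[of t] width_ge[of "Suc t"] by (intro separatedI_far) simp
  have AO: "separated (lower t) (start t) (middle (Suc t)) (start (Suc t) + k + 1)"
    using width_ge[of t] by (intro separatedI_far) simp
  have OZ: "separated (middle t) (start t + k + 1) (upper (Suc t)) (start (Suc t) + width (Suc t))"
    if "t < M"
    using that width_ge[of "Suc t"] by (intro separatedI_far) (simp add: width_def[of t])
  have OO: "separated (middle t) (start t + k + 1) (middle (Suc t)) (start (Suc t) + k + 1)"
    if "t < M"
    using that by (intro separatedI_far) (simp add: width_def)
  from assms show ?thesis
    by (elim in_block.cases; use AA AZ AO ZA ZZ ZO OA OZ OO in simp)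
qed

lemma separated_far_block:
  assumes "in_block t u x" "in_block t' v y" "t + 2 \<le> t'"
  shows "separated u x v y"
proof (rule separatedI_far)
  have "x \<le> start t + width t" using in_block_bounds[OF assms(1)] by simp
  moreover have "start (Suc (Suc t)) \<le> y"
    using start_mono[of "Suc (Suc t)" t'] in_block_bounds[OF assms(2)] assms(3) by simp
  \<comment> \<open>If the block in between is a triple, its width suffices; otherwise both gaps are
    at least \<open>k\<close>, giving \<open>3 * k + 1\<close>.\<close>
  moreover have "2 * k + 2 \<le> gap (Suc t) + width (Suc t) + gap (Suc (Suc t))"
    using k_ge gap_ge[of "Suc t"] gap_ge[of "Suc (Suc t)"] by (auto simp: width_def)
  ultimately show "x + (2 * k + 2) \<le> y" by simp
qed

text \<open>Only \<open>lower 0\<close> has a label close to 0, and there the choice of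
  \<open>start 0\<close> is tight.\<close>

lemma separated_origin:
  assumes "in_block t u x"
  shows "separated (0, k) 0 u x"
proof (cases "t = 0")
  case False
  then have "start (Suc 0) \<le> x"
    using start_mono[of "Suc 0" t] in_block_bounds[OF assms] by simp
  then show ?thesis using M_ge by (intro separatedI_far) (simp add: width_def)
next
  case True
  have "0 < k * M" using k_ge M_ge by simp
  from assms show ?thesis
  proof cases
    case lower
    then show ?thesis using True M_ge \<open>0 < k * M\<close>
      by (simp add: separated_def lower_def lower_offset_def book_dist_def star_dist_def)
  qed (use True M_ge in \<open>auto intro!: separatedI_far simp: width_def\<close>)
qed

lemma labelled_separated:
  assumes "labelled u x" "labelled v y"
  shows "separated u x v y \<or> separated v y u x"
proof -
  consider "u = (0, k)" "x = 0" "v = (0, k)" "y = 0"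
    | t where "u = (0, k)" "x = 0" "in_block t v y"
    | t where "v = (0, k)" "y = 0" "in_block t u x"
    | t t' where "in_block t u x" "in_block t' v y"
    using labelled_cases_block[OF assms(1)] labelled_cases_block[OF assms(2)] by blast
  then show ?thesis
  proof cases
    case (4 t t')
    consider "t = t'" | "t' = Suc t" | "t = Suc t'" | "t + 2 \<le> t'" | "t' + 2 \<le> t" by linarith
    then show ?thesis
    proof cases
      case 1
      then show ?thesis using 4 separated_same_block by simp
    next
      case 2
      then show ?thesis using 4 separated_next_block by simp
    next
      case 3
      then show ?thesis using 4 separated_next_block by simp
    qed (use 4 separated_far_block in simp_all)
  qed (auto simp: separated_def dest: separated_origin)
qed

section \<open>The bound on the radio number\<close>

lemma radio_number_le:
  "radio_number (stacked_book (M + 1) (2 * k + 1)) \<le> (M + 1) * (2 * k * k + 2 * k + 1) + 2 * k"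
proof -
  let ?G = "stacked_book (M + 1) (2 * k + 1)"
  define f where "f u = (SOME x. labelled u x)" for u
  have f: "labelled u (f u)" if "u \<in> pverts ?G" for u
  proof -
    have "\<exists>x. labelled (fst u, snd u) x"
      using that by (intro labelled_exists) (auto simp: pverts_stacked_book)
    then show ?thesis unfolding f_def prod.collapse by (rule someI_ex)
  qed
  have "radio_labeling ?G f"
    unfolding radio_labeling_def
  proof (intro ballI impI)
    fix u v assume uv: "u \<in> pverts ?G" "v \<in> pverts ?G" "u \<noteq> v"
    have "gdist ?G u v = book_dist u v"
      using uv by (intro gdist_stacked_book) (auto simp: pverts_stacked_book)
    \<comment> \<open>An upper bound suffices, since a smaller diameter only weakens the radio
      condition.\<close>
    moreover have "diam ?G \<le> 2 * k + 2" using diam_stacked_book_le[of "M + 1" "2 * k + 1"] by simp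
    ultimately show "int (diam ?G) + 1 - int (gdist ?G u v) \<le> \<bar>int (f u) - int (f v)\<bar>"
      using labelled_separated[OF f f, OF uv(1,2)] uv(3) book_dist_commute[of u v]
      by (auto simp: separated_def)
  qed
  then have "radio_number ?G \<le> label_span ?G f"
    unfolding radio_number_def by (intro Least_le) blast
  also have "\<dots> \<le> Max (f ` pverts ?G)" by (simp add: label_span_def)
  also have "\<dots> \<le> (M + 1) * (2 * k * k + 2 * k + 1) + 2 * k"
  proof (rule Max.boundedI)
    show "finite (f ` pverts ?G)" "f ` pverts ?G \<noteq> {}"
      by (auto simp: pverts_stacked_book)
  qed (use f labelled_le in blast)
  finally show ?thesis .
qed

end

theorem mainTheorem1:
  fixes m n :: nat
  assumes "m \<ge> 5" and "n \<ge> 5" and "odd n"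
  shows "real (radio_number (stacked_book m n))
           \<le> 1 / 2 * (real m * real n ^ 2 + 2 * real n + real m - 2)"
proof -
  obtain k where n: "n = 2 * k + 1" using \<open>odd n\<close> by (elim oddE)
  define M where "M = m - 1"
  have m: "m = M + 1" using assms by (simp add: M_def)
  interpret book_labeling k M by unfold_locales (use assms n m in auto)
  have "real (radio_number (stacked_book m n)) \<le>
      real ((M + 1) * (2 * k * k + 2 * k + 1) + 2 * k)"
    unfolding n m by (intro of_nat_mono radio_number_le)
  \<comment> \<open>With \<open>n = 2 * k + 1\<close>, \<open>2 * k * k + 2 * k + 1\<close> is half
    of \<open>n ^ 2 + 1\<close>, and \<open>2 * k\<close> is \<open>n - 1\<close>.\<close>
  also have "\<dots> = 1 / 2 * (real m * real n ^ 2 + 2 * real n + real m - 2)"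
    by (simp add: n m power2_eq_square algebra_simps)
  finally show ?thesis .
qed

end
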